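(* Let $w\in S_n$ be a permutation. If the elusive minors form the reduced Gröbner basis of the Schubert determinantal ideal $I_w$ with respect to an anti-diagonal term order, then $w$ is vexillary.
   Context: Let $K$ be a field, $X=(x_{ij})$ a generic $n\times n$ matrix of distinct variables, $K[\boldsymbol{x}]$ the polynomial ring in its entries, and $[n]=\{1,\dots,n\}$. For a matrix $M$, $M_{pq}$ is its northwest $p\times q$ submatrix. For $w=w_1\cdots w_n\in S_n$ (one-line notation), $w^T$ is the $n\times n$ permutation matrix whose $i$th row has $1$ in column $w_i$ and $0$ elsewhere. The Schubert determinantal ideal $I_w\subseteq K[\boldsymbol{x}]$ is generated by all minors of $X_{pq}$ of size $\mathrm{rank}(w^T_{pq})+1$ for all $p,q\in[n]$. The Rothe diagram $D(w)$ is the set of boxes of an $n\times n$ square remaining after removing, for each $i$, the box $(i,w_i)$, all boxes $(k,w_i)$ with $k>i$ (directly south), and all boxes $(i,l)$ with $l>w_i$ (directly east). The essential set is $\mathrm{Ess}(w)=\{(p,q)\in D(w): (p,q+1)\notin D(w)\text{ and }(p+1,q)\notin D(w)\}$. The Fulton generators of $I_w$ are the minors of $X_{pq}$ of size $\mathrm{rank}(w^T_{pq})+1$ for $(p,q)\in\mathrm{Ess}(w)$; they generate $I_w$. $w$ is vexillary if there are no $1\le i<j<k<\ell\le n$ with $w_j<w_i<w_\ell<w_k$. A minor $\boldsymbol{m}$ of $X$ is represented by its row and column index sets $R(\boldsymbol{m}),C(\boldsymbol{m})$. Let $\boldsymbol{m}$ be a Fulton generator for $(p,q)\in\mathrm{Ess}(w)$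 and $(\tilde p,\tilde q)\in\mathrm{Ess}(w)$ distinct from $(p,q)$. Then $\boldsymbol{m}$ attends $X_{\tilde p\tilde q}$ if (1) $\#(R(\boldsymbol{m})\cap[\tilde p])\ge\mathrm{rank}(w^T_{\tilde p\tilde q})+1$ and $\#(C(\boldsymbol{m})\cap[\tilde q])=\mathrm{rank}(w^T_{pq})+1$, or (2) $\#(R(\boldsymbol{m})\cap[\tilde p])=\mathrm{rank}(w^T_{pq})+1$ and $\#(C(\boldsymbol{m})\cap[\tilde q])\ge\mathrm{rank}(w^T_{\tilde p\tilde q})+1$. A Fulton generator for $(p,q)\in\mathrm{Ess}(w)$ is elusive if it does not attend $X_{\tilde p\tilde q}$ for any $(\tilde p,\tilde q)\in\mathrm{Ess}(w)\setminus\{(p,q)\}$ with $\mathrm{rank}(w^T_{\tilde p\tilde q})<\mathrm{rank}(w^T_{pq})$. A term order is anti-diagonal if the leading term of every minor of $X$ is the product of the anti-diagonal entries of the corresponding submatrix. A Gröbner basis $\mathcal{G}$ is reduced if for each $G\in\mathcal{G}$ no term of $G$ is divisible by the leading term of an element of $\mathcal{G}\setminus\{G\}$, and the leading coefficient of $G$ is $\pm1$ (uniqueness is up to signs). *)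

theory Defs
  imports
    "HOL-Library.Poly_Mapping"
    "HOL-Combinatorics.Permutations"
    "HOL-Algebra.Ideal"
    "Jordan_Normal_Form.Determinant"
    "Jordan_Normal_Form.DL_Rank"
    "Jordan_Normal_Form.DL_Submatrix"
begin

subsection \<open>The polynomial ring in the entries of a generic matrix\<close>

text \<open>
  A monomial is its exponent vector, so multiplication of monomials is addition and the
  monomial 1 is 0. A polynomial is a finitely supported function from monomials to coefficients.
  Variables are indexed by all pairs of naturals; the ring in the variables
  \<open>x\<^sub>i\<^sub>j\<close> with \<open>i, j \<in> {1..n}\<close> is a subset of this type.
\<close>

type_synonym monomial = "(nat \<times> nat) \<Rightarrow>\<^sub>0 nat"
type_synonym 'k mpoly = "monomial \<Rightarrow>\<^sub>0 'k"

definition monomials :: "nat \<Rightarrow> monomial set" where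
  "monomials n = {m. Poly_Mapping.keys m \<subseteq> {1..n} \<times> {1..n}}"

definition poly_ring :: "nat \<Rightarrow> 'k::field mpoly ring" where
  "poly_ring n = \<lparr>carrier = {f. Poly_Mapping.keys f \<subseteq> monomials n}, monoid.mult = (*), one = 1, zero = 0, add = (+)\<rparr>"

definition var :: "nat \<Rightarrow> nat \<Rightarrow> 'k::field mpoly" where
  "var i j = Poly_Mapping.single (Poly_Mapping.single (i, j) 1) 1"

lemma monomials_add: "a \<in> monomials n \<Longrightarrow> b \<in> monomials n \<Longrightarrow> a + b \<in> monomials n"
  unfolding monomials_def using Poly_Mapping.keys_add[of a b] by blast

lemma cring_poly_ring: "cring (poly_ring n :: 'k::field mpoly ring)"
proof (rule cringI)
  show "abelian_group (poly_ring n :: 'k mpoly ring)"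
  proof (rule abelian_groupI)
    fix f :: "'k mpoly" assume "f \<in> carrier (poly_ring n)"
    then show "\<exists>g\<in>carrier (poly_ring n). g \<oplus>\<^bsub>poly_ring n\<^esub> f = \<zero>\<^bsub>poly_ring n\<^esub>"
      by (intro bexI[of _ "- f"]) (auto simp: poly_ring_def in_keys_iff)
  qed (use keys_add in \<open>force simp: poly_ring_def algebra_simps\<close>)+
  show "Group.comm_monoid (poly_ring n :: 'k mpoly ring)"
  proof (rule comm_monoidI)
    fix f g :: "'k mpoly" assume "f \<in> carrier (poly_ring n)" "g \<in> carrier (poly_ring n)"
    then show "f \<otimes>\<^bsub>poly_ring n\<^esub> g \<in> carrier (poly_ring n)"
      using Poly_Mapping.keys_mult[of f g] monomials_add by (fastforce simp: poly_ring_def)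
  qed (auto simp: poly_ring_def monomials_def algebra_simps)
qed (auto simp: poly_ring_def algebra_simps)


subsection \<open>Term orders and Groebner bases\<close>

definition term_order :: "nat \<Rightarrow> monomial rel \<Rightarrow> bool" where
  "term_order n r \<longleftrightarrow> well_order_on (monomials n) r \<and>
     (\<forall>a\<in>monomials n. \<forall>b\<in>monomials n. \<forall>c\<in>monomials n. (a, b) \<in> r \<longrightarrow> (a + c, b + c) \<in> r)"

text \<open>
  The leading term is taken without its coefficient; it is only meaningful for \<open>f \<noteq> 0\<close>.
\<close>

definition lead_monomial :: "monomial rel \<Rightarrow> 'k::field mpoly \<Rightarrow> monomial" where
  "lead_monomial r f = (THE m. m \<in> Poly_Mapping.keys f \<and> (\<forall>m'\<in>Poly_Mapping.keys f. (m', m) \<in> r))"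

definition lead_coefficient :: "monomial rel \<Rightarrow> 'k::field mpoly \<Rightarrow> 'k" where
  "lead_coefficient r f = Poly_Mapping.lookup f (lead_monomial r f)"

definition lead_term :: "monomial rel \<Rightarrow> 'k::field mpoly \<Rightarrow> 'k mpoly" where
  "lead_term r f = Poly_Mapping.single (lead_monomial r f) 1"

definition monomial_dvd :: "monomial \<Rightarrow> monomial \<Rightarrow> bool" where
  "monomial_dvd a b \<longleftrightarrow> (\<exists>c. b = a + c)"

definition initial_ideal :: "nat \<Rightarrow> monomial rel \<Rightarrow> 'k::field mpoly set \<Rightarrow> 'k mpoly set" where
  "initial_ideal n r S = Idl\<^bsub>poly_ring n\<^esub> (lead_term r ` (S - {0}))"

definition groebner_basis ::
    "nat \<Rightarrow> monomial rel \<Rightarrow> 'k::field mpoly set \<Rightarrow> 'k mpoly set \<Rightarrow> bool" where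
  "groebner_basis n r I G \<longleftrightarrow> finite G \<and> G \<subseteq> I \<and> initial_ideal n r G = initial_ideal n r I"

definition reduced_groebner_basis ::
    "nat \<Rightarrow> monomial rel \<Rightarrow> 'k::field mpoly set \<Rightarrow> 'k mpoly set \<Rightarrow> bool" where
  "reduced_groebner_basis n r I G \<longleftrightarrow> groebner_basis n r I G \<and>
     (\<forall>g\<in>G. g \<noteq> 0 \<and> lead_coefficient r g \<in> {1, -1} \<and>
        (\<forall>h\<in>G - {g}. \<forall>m\<in>Poly_Mapping.keys g. \<not> monomial_dvd (lead_monomial r h) m))"


subsection \<open>Matrices and minors\<close>

text \<open>
  Row and column indices of the mathematical objects start at 1, whereas those of the type of
  matrices start at 0; the index sets are translated by \<^term>\<open>\<lambda>S. Suc -` S\<close>.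
\<close>

definition generic_matrix :: "nat \<Rightarrow> 'k::field mpoly mat" where
  "generic_matrix n = mat n n (\<lambda>(i, j). var (Suc i) (Suc j))"

definition minor_matrix :: "nat \<Rightarrow> nat set \<Rightarrow> nat set \<Rightarrow> 'k::field mpoly mat" where
  "minor_matrix n R C = submatrix (generic_matrix n) (Suc -` R) (Suc -` C)"

definition minor :: "nat \<Rightarrow> nat set \<Rightarrow> nat set \<Rightarrow> 'k::field mpoly" where
  "minor n R C = det (minor_matrix n R C)"

text \<open>The index sets \<open>(R, C)\<close> of the size \<open>k\<close> minors of the northwest submatrix \<open>X\<^sub>p\<^sub>q\<close>.\<close>

definition minor_indices :: "nat \<Rightarrow> nat \<Rightarrow> nat \<Rightarrow> (nat set \<times> nat set) set" where
  "minor_indices p q k = {(R, C). R \<subseteq> {1..p} \<and> C \<subseteq> {1..q} \<and> card R = k \<and> card C = k}"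

text \<open>The type argument only fixes the coefficient field.\<close>

definition antidiagonal_term_order :: "'k::field itself \<Rightarrow> nat \<Rightarrow> monomial rel \<Rightarrow> bool" where
  "antidiagonal_term_order K n r \<longleftrightarrow> term_order n r \<and>
     (\<forall>k\<in>{1..n}. \<forall>(R, C)\<in>minor_indices n n k.
        lead_term r (minor n R C :: 'k mpoly) =
          (\<Prod>i<k. (minor_matrix n R C :: 'k mpoly mat) $$ (i, k - 1 - i)))"


subsection \<open>Permutations and Schubert determinantal ideals\<close>

text \<open>
  The rank of the 0/1 matrix \<open>w\<^sup>T\<^sub>p\<^sub>q\<close> (a partial permutation matrix) does not depend on the
  field; it is computed over the rationals.
\<close>

definition perm_matrix :: "nat \<Rightarrow> (nat \<Rightarrow> nat) \<Rightarrow> rat mat" where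
  "perm_matrix n w = mat n n (\<lambda>(i, j). if w (Suc i) = Suc j then 1 else 0)"

definition nw_rank :: "nat \<Rightarrow> (nat \<Rightarrow> nat) \<Rightarrow> nat \<Rightarrow> nat \<Rightarrow> nat" where
  "nw_rank n w p q = vec_space.rank p (submatrix (perm_matrix n w) {..<p} {..<q})"

definition schubert_ideal :: "nat \<Rightarrow> (nat \<Rightarrow> nat) \<Rightarrow> 'k::field mpoly set" where
  "schubert_ideal n w = Idl\<^bsub>poly_ring n\<^esub>
     {minor n R C | R C p q. p \<in> {1..n} \<and> q \<in> {1..n} \<and>
        (R, C) \<in> minor_indices p q (nw_rank n w p q + 1)}"

definition rothe_diagram :: "nat \<Rightarrow> (nat \<Rightarrow> nat) \<Rightarrow> (nat \<times> nat) set" where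
  "rothe_diagram n w = {1..n} \<times> {1..n} -
     (\<Union>i\<in>{1..n}. {(i, w i)} \<union> {(k, w i) | k. k > i} \<union> {(i, l) | l. l > w i})"

definition essential_set :: "nat \<Rightarrow> (nat \<Rightarrow> nat) \<Rightarrow> (nat \<times> nat) set" where
  "essential_set n w = {(p, q) \<in> rothe_diagram n w.
     (p, q + 1) \<notin> rothe_diagram n w \<and> (p + 1, q) \<notin> rothe_diagram n w}"

definition fulton_indices ::
    "nat \<Rightarrow> (nat \<Rightarrow> nat) \<Rightarrow> nat \<Rightarrow> nat \<Rightarrow> (nat set \<times> nat set) set" where
  "fulton_indices n w p q = minor_indices p q (nw_rank n w p q + 1)"

text \<open>
  \<open>attends n w (p, q) (R, C) (p', q')\<close>: the Fulton generator for \<open>(p, q)\<close> with index sets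
  \<open>R\<close> and \<open>C\<close> attends \<open>X\<^sub>p\<^sub>'\<^sub>q\<^sub>'\<close>.
\<close>

fun attends ::
    "nat \<Rightarrow> (nat \<Rightarrow> nat) \<Rightarrow> nat \<times> nat \<Rightarrow> nat set \<times> nat set \<Rightarrow> nat \<times> nat \<Rightarrow> bool" where
  "attends n w (p, q) (R, C) (p', q') \<longleftrightarrow>
     (card (R \<inter> {1..p'}) \<ge> nw_rank n w p' q' + 1 \<and> card (C \<inter> {1..q'}) = nw_rank n w p q + 1) \<or>
     (card (R \<inter> {1..p'}) = nw_rank n w p q + 1 \<and> card (C \<inter> {1..q'}) \<ge> nw_rank n w p' q' + 1)"

definition elusive ::
    "nat \<Rightarrow> (nat \<Rightarrow> nat) \<Rightarrow> nat \<times> nat \<Rightarrow> nat set \<times> nat set \<Rightarrow> bool" where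
  "elusive n w = (\<lambda>(p, q) (R, C). (R, C) \<in> fulton_indices n w p q \<and>
     (\<forall>(p', q')\<in>essential_set n w - {(p, q)}.
        nw_rank n w p' q' < nw_rank n w p q \<longrightarrow> \<not> attends n w (p, q) (R, C) (p', q')))"

definition elusive_minors :: "nat \<Rightarrow> (nat \<Rightarrow> nat) \<Rightarrow> 'k::field mpoly set" where
  "elusive_minors n w =
     {minor n R C | R C p q. (p, q) \<in> essential_set n w \<and> elusive n w (p, q) (R, C)}"

definition vexillary :: "nat \<Rightarrow> (nat \<Rightarrow> nat) \<Rightarrow> bool" where
  "vexillary n w \<longleftrightarrow> \<not> (\<exists>i j k l. 1 \<le> i \<and> i < j \<and> j < k \<and> k < l \<and> l \<le> n \<and>
     w j < w i \<and> w i < w l \<and> w l < w k)"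

end

theory Submission
  imports Defs
begin

text \<open>
  The proof is by contraposition. Reducedness fails as soon as one elusive minor has its index sets
  properly inside those of another one: the antidiagonal of the small minor extends to a full
  transversal of the large one, and since no terms of a generic minor cancel, the leading term
  of the small minor divides a term of the large one
  (\<open>lead_monomial_dvd_term_of_larger_minor\<close>).

  A nonvexillary \<open>w\<close> has essential boxes \<open>(p, q)\<close> and \<open>(p', q')\<close>, of ranks \<open>r\<close> and \<open>r'\<close>, the
  second strictly southeast of the first (\<open>nonvexillary_essential_pair\<close>); then \<open>r < r'\<close>. It is
  enough to find one elusive minor of \<open>X\<^sub>p\<^sub>'\<^sub>q\<^sub>'\<close> with at least \<open>r + 1\<close> rows in \<open>{1..p}\<close> and
  \<open>r + 1\<close> columns in \<open>{1..q}\<close>. It contains a Fulton generator for \<open>(p, q)\<close>, and a Fulton generator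
  that is not elusive contains one for a box of smaller rank, so that descent in the rank
  reaches an elusive minor of smaller size inside the given one (\<open>contains_elusive\<close>).

  To be elusive the large minor must not have many of its rows far to the north while its columns
  lie in \<open>{1..b}\<close>, and vice versa. So its rows and columns are chosen as late as the requirement
  on \<open>(p, q)\<close> permits (\<open>late_subset\<close>). For essential boxes \<open>(a, b)\<close> with \<open>a \<le> p\<close> and \<open>q' \<le> b\<close>
  this suffices because removing rows from a northwest block removes at most one dot per row,
  and one dot fewer when the block ends at a diagram box; for \<open>a = p\<close> the missing dot is the one
  in column \<open>q + 1\<close>. Boxes with \<open>p < a < p'\<close> cannot be handled
  in this way; they are excluded by taking a pair with the least possible \<open>r'\<close>, as otherwise
  \<open>(p, q)\<close> and \<open>(a, b)\<close> would be a pair of smaller rank (\<open>elusive_containing_smaller_fulton_indices\<close>).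
\<close>

section \<open>Ranks and diagrams by counting dots\<close>

definition dot_count :: "(nat \<Rightarrow> nat) \<Rightarrow> nat \<Rightarrow> nat \<Rightarrow> nat" where
  "dot_count w p q = card {i \<in> {1..p}. w i \<le> q}"

lemma permutes_pos_iff:
  fixes w :: "nat \<Rightarrow> nat"
  assumes "w permutes {1..n}"
  shows "0 < w i \<longleftrightarrow> 0 < i"
proof -
  have "w 0 = 0" using permutes_not_in[OF assms, of 0] by simp
  then show ?thesis using permutes_inj[OF assms] by (metis injD neq0_conv)
qed

lemma pick_lessThan: "i < p \<Longrightarrow> pick {..<p} i = i"
proof -
  assume i: "i < p"
  then have "{a \<in> {..<p}. a < i} = {..<i}" by auto
  with pick_card_in_set[of i "{..<p}"] i show ?thesis by simp
qed

text \<open>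
  The nonzero columns of a northwest block of a permutation matrix are distinct unit vectors, one
  for each dot in the block, so they form a maximal independent set of columns.
\<close>

lemma nw_rank_eq_dot_count:
  assumes w: "w permutes {1..n}" and p: "p \<le> n" and q: "q \<le> n"
  shows "nw_rank n w p q = dot_count w p q"
proof -
  interpret vec_space "TYPE(rat)" p .
  let ?A = "submatrix (perm_matrix n w) {..<p} {..<q}"
  let ?I = "{i. i < p \<and> w (Suc i) \<le> q}"
  let ?S = "unit_vec p ` ?I :: rat vec set"
  have rows: "{i. i < n \<and> i \<in> {..<p}} = {..<p}" and columns: "{j. j < n \<and> j \<in> {..<q}} = {..<q}"
    using p q by auto
  have A: "?A = mat p q (\<lambda>(i, j). if w (Suc i) = Suc j then 1 else 0)"
    unfolding submatrix_def perm_matrix_def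
    using rows columns p q by (intro eq_matI) (auto simp: pick_lessThan)
  have pos: "w (Suc i) \<noteq> 0" for i
    using permutes_pos_iff[OF w, of "Suc i"] by simp
  have col_dot: "col ?A j = unit_vec p i" if "i < p" "j < q" "w (Suc i) = Suc j" for i j
  proof -
    have "w (Suc i') = Suc j \<longleftrightarrow> i' = i" for i'
      using that(3) permutes_inj[OF w] by (metis Suc_inject injD)
    then show ?thesis
      unfolding A using that by (intro eq_vecI) (auto simp: unit_vec_def)
  qed
  have col_empty: "col ?A j = 0\<^sub>v p" if "j < q" "\<And>i. i < p \<Longrightarrow> w (Suc i) \<noteq> Suc j" for j
    unfolding A using that by (intro eq_vecI) auto
  have cols: "set (cols ?A) = col ?A ` {..<q}"
    unfolding cols_def by (auto simp: A)
  have sub: "set (cols ?A) \<subseteq> insert (0\<^sub>v p) ?S"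
  proof
    fix v assume "v \<in> set (cols ?A)"
    then obtain j where j: "j < q" "v = col ?A j" unfolding cols by auto
    show "v \<in> insert (0\<^sub>v p) ?S"
    proof (cases "\<exists>i<p. w (Suc i) = Suc j")
      case True
      then obtain i where "i < p" "w (Suc i) = Suc j" by auto
      then show ?thesis using col_dot[of i j] j by auto
    next
      case False
      then show ?thesis using col_empty[of j] j by auto
    qed
  qed
  have sup: "?S \<subseteq> set (cols ?A)"
  proof
    fix v assume "v \<in> ?S"
    then obtain i where i: "i < p" "w (Suc i) \<le> q" "v = unit_vec p i" by auto
    then obtain j where "w (Suc i) = Suc j" using pos[of i] by (cases "w (Suc i)") auto
    then have "j < q" "col ?A j = v" using col_dot[of i j] i by auto
    then show "v \<in> set (cols ?A)" unfolding cols by blast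
  qed
  have units: "?S \<subseteq> set (unit_vecs p)" by (auto simp: unit_vecs_def)
  have indep: "lin_indpt ?S"
    using subset_li_is_li[OF _ units] unit_vecs_basis unfolding basis_def by auto
  have "maximal ?S (\<lambda>T. T \<subseteq> set (cols ?A) \<and> lin_indpt T)"
    unfolding maximal_def
  proof (intro conjI allI impI)
    fix T assume T: "?S \<subseteq> T \<and> T \<subseteq> set (cols ?A) \<and> lin_indpt T"
    have "T \<subseteq> carrier_vec p" using T cols_dim[of ?A] by (auto simp: A)
    then have "0\<^sub>v p \<notin> T" using zero_nin_lin_indpt[of T] T class_semiring.one_zeroI by auto
    then show "T = ?S" using T sub by auto
  qed (use indep sup in auto)
  then have "rank ?A = card ?S" by (intro rank_card_indpt[of _ q]) (auto simp: A)
  also have "\<dots> = card ?I"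
    by (rule card_image) (auto simp: inj_on_def)
  also have "\<dots> = card (Suc ` ?I)" by (simp add: card_image)
  also have "Suc ` ?I = {i \<in> {1..p}. w i \<le> q}"
    by (auto simp: image_iff Suc_le_eq) (metis Suc_pred Suc_le_lessD One_nat_def)
  finally show ?thesis unfolding nw_rank_def dot_count_def by simp
qed

lemma finite_dots: "finite {i \<in> {1..p}. w i \<le> (q :: nat)}" for p :: nat
  by (rule finite_subset[of _ "{1..p}"]) auto

lemma dot_count_mono: "p \<le> p' \<Longrightarrow> q \<le> q' \<Longrightarrow> dot_count w p q \<le> dot_count w p' q'"
  unfolding dot_count_def by (intro card_mono finite_dots) auto

text \<open>
  Inverting the permutation transposes the dots, so every statement about rows yields the
  corresponding statement about columns. (The plain notation for the inverse is taken by groups.)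
\<close>

lemma dot_count_inv:
  assumes w: "w permutes {1..n}"
  shows "dot_count (Hilbert_Choice.inv w) q p = dot_count w p q"
proof -
  have "bij_betw w {i \<in> {1..p}. w i \<le> q} {j \<in> {1..q}. Hilbert_Choice.inv w j \<le> p}"
  proof (rule bij_betw_byWitness[where f' = "Hilbert_Choice.inv w"])
  qed (use permutes_pos_iff[OF w] permutes_pos_iff[OF permutes_inv[OF w]] permutes_inverses[OF w]
      in \<open>auto simp: Suc_le_eq\<close>)
  then show ?thesis unfolding dot_count_def by (simp add: bij_betw_same_card)
qed

lemma rothe_diagram_iff:
  assumes w: "w permutes {1..n}"
  shows "(p, q) \<in> rothe_diagram n w \<longleftrightarrow>
    p \<in> {1..n} \<and> q \<in> {1..n} \<and> q < w p \<and> p < Hilbert_Choice.inv w q"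
proof -
  let ?i = "Hilbert_Choice.inv w q"
  have i: "w ?i = q" using permutes_inverses[OF w] by simp
  have col: "(\<forall>k\<in>{1..n}. w k = q \<longrightarrow> \<not> k \<le> p) \<longleftrightarrow> p < ?i" if q: "q \<in> {1..n}"
  proof
    have "?i \<in> {1..n}" using permutes_in_image[OF permutes_inv[OF w]] q by simp
    then show "p < ?i" if "\<forall>k\<in>{1..n}. w k = q \<longrightarrow> \<not> k \<le> p" using that i not_le by blast
  next
    assume less: "p < ?i"
    show "\<forall>k\<in>{1..n}. w k = q \<longrightarrow> \<not> k \<le> p"
    proof (intro ballI impI)
      fix k assume "w k = q"
      then have "k = ?i" using permutes_inverses(2)[OF w, of k] by simp
      then show "\<not> k \<le> p" using less by linarith
    qed
  qed
  have "(p, q) \<in> rothe_diagram n w \<longleftrightarrow> p \<in> {1..n} \<and> q \<in> {1..n} \<and>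
     (\<forall>k\<in>{1..n}. (p, q) \<noteq> (k, w k) \<and> \<not> (q = w k \<and> k < p) \<and> \<not> (p = k \<and> w k < q))"
    unfolding rothe_diagram_def by auto
  also have "\<dots> \<longleftrightarrow> p \<in> {1..n} \<and> q \<in> {1..n} \<and>
     (\<forall>k\<in>{1..n}. w k = q \<longrightarrow> \<not> k \<le> p) \<and> \<not> w p \<le> q"
    unfolding le_less prod.inject by blast
  also have "\<dots> \<longleftrightarrow> p \<in> {1..n} \<and> q \<in> {1..n} \<and> q < w p \<and> p < ?i"
    using col by (auto simp only: not_le)
  finally show ?thesis .
qed

lemma rothe_diagram_inv:
  assumes "w permutes {1..n}"
  shows "(q, p) \<in> rothe_diagram n (Hilbert_Choice.inv w) \<longleftrightarrow> (p, q) \<in> rothe_diagram n w"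
  unfolding rothe_diagram_iff[OF assms] rothe_diagram_iff[OF permutes_inv[OF assms]]
    permutes_inv_inv[OF assms] by blast

lemma essential_set_iff:
  "(p, q) \<in> essential_set n w \<longleftrightarrow> (p, q) \<in> rothe_diagram n w \<and>
     (p, Suc q) \<notin> rothe_diagram n w \<and> (Suc p, q) \<notin> rothe_diagram n w"
  unfolding essential_set_def by auto

lemma essential_set_inv:
  assumes "w permutes {1..n}"
  shows "(q, p) \<in> essential_set n (Hilbert_Choice.inv w) \<longleftrightarrow> (p, q) \<in> essential_set n w"
  unfolding essential_set_iff rothe_diagram_inv[OF assms] by auto

lemma essential_set_bounds:
  "(p, q) \<in> essential_set n w \<Longrightarrow> p \<in> {1..n} \<and> q \<in> {1..n}"
  unfolding essential_set_def rothe_diagram_def by auto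

lemma nw_rank_essential:
  assumes "w permutes {1..n}" "(p, q) \<in> essential_set n w"
  shows "nw_rank n w p q = dot_count w p q"
  using nw_rank_eq_dot_count[OF assms(1)] essential_set_bounds[OF assms(2)] by simp

text \<open>
  Each row contains only one dot, and row \<open>p\<close> of a diagram box contributes none, so removing rows
  from the bottom of the block drops the count by less than the number of rows removed.
\<close>

lemma dot_count_diagram:
  assumes w: "w permutes {1..n}" and D: "(p, q) \<in> rothe_diagram n w" and "a < p" "q \<le> b"
  shows "dot_count w p q + 1 \<le> dot_count w a b + (p - a)"
proof -
  have "{i \<in> {1..p}. w i \<le> q} \<subseteq> {i \<in> {1..a}. w i \<le> b} \<union> {a<..<p}"
  proof
    fix i assume i: "i \<in> {i \<in> {1..p}. w i \<le> q}"
    have "q < w p" using D unfolding rothe_diagram_iff[OF w] by blast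
    then have "i \<noteq> p" using i by auto
    then show "i \<in> {i \<in> {1..a}. w i \<le> b} \<union> {a<..<p}" using i \<open>q \<le> b\<close> by auto
  qed
  then have "card {i \<in> {1..p}. w i \<le> q} \<le> card ({i \<in> {1..a}. w i \<le> b} \<union> {a<..<p})"
    by (intro card_mono finite_UnI finite_dots) auto
  also have "\<dots> \<le> card {i \<in> {1..a}. w i \<le> b} + (p - a - 1)"
    by (rule order_trans[OF card_Un_le]) simp
  finally show ?thesis using \<open>a < p\<close> unfolding dot_count_def by linarith
qed

text \<open>
  At an essential box the same gain is available for \<open>a = p\<close> once the block is widened, because
  the column directly to the east has its dot in one of the rows up to \<open>p\<close>.
\<close>

lemma dot_count_essential:
  assumes w: "w permutes {1..n}" and E: "(p, q) \<in> essential_set n w" and "a \<le> p" "q < b"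
  shows "dot_count w p q + 1 \<le> dot_count w a b + (p - a)"
proof (cases "a = p")
  case False
  then show ?thesis using dot_count_diagram[OF w, of p q a b] E assms(3,4)
    unfolding essential_set_def by auto
next
  case True
  have D: "p \<in> {1..n}" "q \<in> {1..n}" "q < w p" "p < Hilbert_Choice.inv w q"
    and E': "(p, Suc q) \<notin> rothe_diagram n w"
    using E unfolding essential_set_iff rothe_diagram_iff[OF w] by auto
  let ?i = "Hilbert_Choice.inv w (Suc q)"
  have "?i \<le> p"
  proof (cases "w p = Suc q")
    case True
    then have "?i = p" using permutes_inverses[OF w] by metis
    then show ?thesis by simp
  next
    case False
    have "w p \<in> {1..n}" using permutes_in_image[OF w, of p] D by blast
    then have "Suc q < w p" "Suc q \<in> {1..n}" using False D by auto
    then show ?thesis using E' D unfolding rothe_diagram_iff[OF w] by auto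
  qed
  moreover have "?i \<ge> 1" using permutes_pos_iff[OF permutes_inv[OF w], of "Suc q"] by simp
  moreover have wi: "w ?i = Suc q" using permutes_inverses[OF w] by simp
  ultimately have "insert ?i {i \<in> {1..p}. w i \<le> q} \<subseteq> {i \<in> {1..p}. w i \<le> b}"
    using \<open>q < b\<close> by auto
  then have "card (insert ?i {i \<in> {1..p}. w i \<le> q}) \<le> card {i \<in> {1..p}. w i \<le> b}"
    by (intro card_mono finite_dots)
  moreover have "?i \<notin> {i \<in> {1..p}. w i \<le> q}" using wi by auto
  ultimately show ?thesis using True finite_dots[of p w q] unfolding dot_count_def by simp
qed

lemma dot_count_essential_less:
  assumes "w permutes {1..n}" "(p, q) \<in> essential_set n w" "p < p'" "q < q'"
  shows "dot_count w p q < dot_count w p' q'"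
  using dot_count_essential[OF assms(1,2), of p q'] dot_count_mono[of p p' q' q' w] assms(3,4) by simp

lemma dot_count_less_row:
  assumes "w permutes {1..n}" "(p, q) \<in> rothe_diagram n w"
  shows "dot_count w p q < p"
  using dot_count_diagram[OF assms, of 0 q] assms(2) unfolding rothe_diagram_iff[OF assms(1)]
  by (auto simp: dot_count_def)

section \<open>Essential boxes of a nonvexillary permutation\<close>

text \<open>
  A box of a region of the diagram that is closed under unit steps to the east and to the south
  inside the diagram leads to an essential box of the region: take one furthest to the southeast.
\<close>

lemma essential_box_in_region:
  assumes "(a, b) \<in> rothe_diagram n w" "P a b"
    and east: "\<And>p q. (p, Suc q) \<in> rothe_diagram n w \<Longrightarrow> P p q \<Longrightarrow> P p (Suc q)"
    and south: "\<And>p q. (Suc p, q) \<in> rothe_diagram n w \<Longrightarrow> P p q \<Longrightarrow> P (Suc p) q"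
  shows "\<exists>(p, q) \<in> essential_set n w. P p q"
proof -
  let ?B = "\<lambda>x. x \<in> rothe_diagram n w \<and> P (fst x) (snd x)"
  have bounded: "\<forall>x. ?B x \<longrightarrow> fst x + snd x < Suc (2 * n)"
    unfolding rothe_diagram_def by auto
  obtain x where x: "?B x" and max: "\<forall>y. ?B y \<longrightarrow> fst y + snd y \<le> fst x + snd x"
    using ex_has_greatest_nat[of ?B "(a, b)" "\<lambda>x. fst x + snd x", OF _ bounded] assms(1,2)
    by auto
  obtain p q where [simp]: "x = (p, q)" by (cases x)
  have "(p, Suc q) \<notin> rothe_diagram n w" using max[rule_format, of "(p, Suc q)"] east x by auto
  moreover have "(Suc p, q) \<notin> rothe_diagram n w"
    using max[rule_format, of "(Suc p, q)"] south x by auto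
  ultimately show ?thesis using x unfolding essential_set_def by (intro bexI[of _ x]) auto
qed

text \<open>
  A pattern \<open>w\<^sub>j < w\<^sub>i < w\<^sub>l < w\<^sub>k\<close> puts the boxes \<open>(i, w\<^sub>j)\<close> and \<open>(k, w\<^sub>l)\<close> into the diagram. Moving
  from the first one to the southeast, the dots in row \<open>j\<close> and in column \<open>w\<^sub>i\<close> cannot be passed, so
  one stays strictly northwest of the second.
\<close>

lemma nonvexillary_essential_pair:
  assumes w: "w permutes {1..n}" and "\<not> vexillary n w"
  shows "\<exists>p q p' q'. (p, q) \<in> essential_set n w \<and> (p', q') \<in> essential_set n w \<and> p < p' \<and> q < q'"
proof -
  obtain i j k l where idx: "1 \<le> i" "i < j" "j < k" "k < l" "l \<le> n"
    and val: "w j < w i" "w i < w l" "w l < w k"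
    using assms(2) unfolding vexillary_def by blast
  have range: "w x \<in> {1..n}" if "x \<in> {1..n}" for x
    using permutes_in_image[OF w] that by simp
  have "(i, w j) \<in> rothe_diagram n w" "(k, w l) \<in> rothe_diagram n w"
    unfolding rothe_diagram_iff[OF w] using idx val range[of j] range[of l] permutes_inverses[OF w]
    by auto
  note boxes = this
  have "\<exists>(p, q)\<in>essential_set n w. i \<le> p \<and> p < j \<and> w j \<le> q \<and> q < w i"
  proof (rule essential_box_in_region[OF boxes(1)])
    fix p q assume D: "(p, Suc q) \<in> rothe_diagram n w" and P: "i \<le> p \<and> p < j \<and> w j \<le> q \<and> q < w i"
    then have "Suc q \<noteq> w i" using permutes_inverses[OF w] unfolding rothe_diagram_iff[OF w] by auto
    then show "i \<le> p \<and> p < j \<and> w j \<le> Suc q \<and> Suc q < w i" using P by auto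
  next
    fix p q assume D: "(Suc p, q) \<in> rothe_diagram n w" and P: "i \<le> p \<and> p < j \<and> w j \<le> q \<and> q < w i"
    then have "Suc p \<noteq> j" unfolding rothe_diagram_iff[OF w] by auto
    then show "i \<le> Suc p \<and> Suc p < j \<and> w j \<le> q \<and> q < w i" using P by auto
  qed (use idx val in auto)
  moreover have "\<exists>(p, q)\<in>essential_set n w. k \<le> p \<and> w l \<le> q"
    by (rule essential_box_in_region[OF boxes(2)]) auto
  ultimately show ?thesis using idx val by fastforce
qed

section \<open>Nested elusive minors\<close>

text \<open>
  The set consists of final segments of \<open>{1..p}\<close> and of \<open>{1..p'}\<close>: with
  \<open>r + 1\<close> and \<open>r' - r\<close> elements when these do not overlap, and otherwise with \<open>r' + 1\<close>
  elements at the end of \<open>{1..p'}\<close>. Placing the elements as far down as possible keeps every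
  shorter initial segment sparsely populated.
\<close>

lemma late_subset:
  fixes r r' p p' :: nat
  assumes "r < p" "r' < p'" "r < r'" "p < p'"
  obtains R where "R \<subseteq> {1..p'}" "card R = r' + 1" "p' \<in> R" "r + 1 \<le> card (R \<inter> {1..p})"
    "\<And>a. a \<le> p \<Longrightarrow> card (R \<inter> {1..a}) \<le> max (r + 1 - (p - a)) (r' + 1 - (p' - a))"
proof (cases "r' - r \<le> p' - p")
  case True
  let ?R = "{p - r..p} \<union> {p' - (r' - r) + 1..p'}"
  have "card ?R = card {p - r..p} + card {p' - (r' - r) + 1..p'}"
    using True by (intro card_Un_disjoint) auto
  then have "card ?R = r' + 1" using assms by simp
  moreover have "?R \<inter> {1..a} = {p - r..a}" if "a \<le> p" for a
    using that True assms by auto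
  then have "card (?R \<inter> {1..a}) = Suc a - (p - r)" if "a \<le> p" for a
    using that by (metis card_atLeastAtMost)
  ultimately show ?thesis using assms by (intro that[of ?R]) auto
next
  case False
  let ?R = "{p' - r'..p'}"
  have "?R \<inter> {1..a} = {p' - r'..a}" if "a \<le> p" for a
    using that assms by auto
  then have "card (?R \<inter> {1..a}) = Suc a - (p' - r')" if "a \<le> p" for a
    using that by (metis card_atLeastAtMost)
  then show ?thesis using assms False by (intro that[of ?R]) auto
qed

text \<open>
  By the bounds on the number of dots lost when rows are removed, a late row set
  meets the first \<open>a \<le> p\<close> rows too rarely to contain the rows of a Fulton generator of
  \<open>X\<^sub>a\<^sub>b\<close> when \<open>q' \<le> b\<close>.
\<close>

lemma late_rows_for_essential_pair:
  assumes w: "w permutes {1..n}"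
    and E: "(p, q) \<in> essential_set n w" and E': "(p', q') \<in> essential_set n w"
    and less: "p < p'" "q < q'"
  obtains R where "R \<subseteq> {1..p'}" "card R = dot_count w p' q' + 1" "p' \<in> R"
    "dot_count w p q + 1 \<le> card (R \<inter> {1..p})"
    "\<And>a b. a \<le> p \<Longrightarrow> q' \<le> b \<Longrightarrow> card (R \<inter> {1..a}) \<le> dot_count w a b"
proof -
  have D: "(p, q) \<in> rothe_diagram n w" "(p', q') \<in> rothe_diagram n w"
    using E E' unfolding essential_set_iff by auto
  obtain R where R: "R \<subseteq> {1..p'}" "card R = dot_count w p' q' + 1" "p' \<in> R"
    "dot_count w p q + 1 \<le> card (R \<inter> {1..p})"
    and late: "\<And>a. a \<le> p \<Longrightarrow> card (R \<inter> {1..a}) \<le>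
      max (dot_count w p q + 1 - (p - a)) (dot_count w p' q' + 1 - (p' - a))"
    using late_subset[OF dot_count_less_row[OF w D(1)] dot_count_less_row[OF w D(2)]
        dot_count_essential_less[OF w E less] less(1)] by metis
  have "card (R \<inter> {1..a}) \<le> dot_count w a b" if "a \<le> p" "q' \<le> b" for a b
  proof -
    have "dot_count w p q + 1 \<le> dot_count w a b + (p - a)"
      using dot_count_essential[OF w E, of a b] that less by auto
    moreover have "dot_count w p' q' + 1 \<le> dot_count w a b + (p' - a)"
      using dot_count_diagram[OF w D(2), of a b] that less by auto
    ultimately show ?thesis using late[OF that(1)] by linarith
  qed
  with R show ?thesis using that by blast
qed

text \<open>
  For a pair whose southeastern box has the least possible rank, combine late rows with late
  columns. As the last row \<open>p'\<close> and the last column \<open>q'\<close> are used, a box \<open>(a, b)\<close> of smaller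
  rank that is attended lies northeast or southwest of \<open>(p', q')\<close>. In the first case \<open>a \<le> p\<close>, since
  otherwise \<open>(p, q)\<close> and \<open>(a, b)\<close> would be a pair of smaller rank; then there are too few rows.
\<close>

lemma elusive_containing_smaller_fulton_indices:
  assumes w: "w permutes {1..n}"
    and E: "(p, q) \<in> essential_set n w" and E': "(p', q') \<in> essential_set n w"
    and less: "p < p'" "q < q'"
    and minimal: "\<And>a b a' b'. (a, b) \<in> essential_set n w \<Longrightarrow> (a', b') \<in> essential_set n w \<Longrightarrow>
       a < a' \<Longrightarrow> b < b' \<Longrightarrow> dot_count w p' q' \<le> dot_count w a' b'"
  obtains R C where "elusive n w (p', q') (R, C)"
    "dot_count w p q + 1 \<le> card (R \<inter> {1..p})" "dot_count w p q + 1 \<le> card (C \<inter> {1..q})"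
proof -
  obtain R where R: "R \<subseteq> {1..p'}" "card R = dot_count w p' q' + 1" "p' \<in> R"
    "dot_count w p q + 1 \<le> card (R \<inter> {1..p})"
    and lateR: "\<And>a b. a \<le> p \<Longrightarrow> q' \<le> b \<Longrightarrow> card (R \<inter> {1..a}) \<le> dot_count w a b"
    using late_rows_for_essential_pair[OF w E E' less] by metis
  obtain C where C: "C \<subseteq> {1..q'}" "card C = dot_count w p' q' + 1" "q' \<in> C"
    "dot_count w p q + 1 \<le> card (C \<inter> {1..q})"
    and lateC: "\<And>a b. b \<le> q \<Longrightarrow> p' \<le> a \<Longrightarrow> card (C \<inter> {1..b}) \<le> dot_count w a b"
    using late_rows_for_essential_pair[OF permutes_inv[OF w], of q p q' p']
      E E' less essential_set_inv[OF w] unfolding dot_count_inv[OF w] by metis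
  have last: "m \<le> c" if "finite S" "m \<in> S" "card (S \<inter> {1..c}) = card S" for S c and m :: nat
  proof -
    have "S \<inter> {1..c} = S" using that by (intro card_subset_eq) auto
    then show ?thesis using that by auto
  qed
  have fin: "finite R" "finite C" using R(1) C(1) by (auto intro: finite_subset)
  have "\<not> attends n w (p', q') (R, C) (a, b)"
    if ab: "(a, b) \<in> essential_set n w" and rank: "nw_rank n w a b < nw_rank n w p' q'" for a b
  proof
    have rank': "dot_count w a b < dot_count w p' q'"
      using rank nw_rank_essential[OF w] ab E' by simp
    have not_pair: "a \<le> p \<or> b \<le> q"
      using minimal[OF E ab] rank' by force
    assume "attends n w (p', q') (R, C) (a, b)"
    then consider
        "dot_count w a b + 1 \<le> card (R \<inter> {1..a})" "card (C \<inter> {1..b}) = card C"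
      | "dot_count w a b + 1 \<le> card (C \<inter> {1..b})" "card (R \<inter> {1..a}) = card R"
      using nw_rank_essential[OF w ab] nw_rank_essential[OF w E'] R C by auto
    then show False
    proof cases
      case 1
      then have "q' \<le> b" using last fin C by blast
      then have "a \<le> p" using not_pair less by auto
      then show False using lateR[of a b] 1 \<open>q' \<le> b\<close> by simp
    next
      case 2
      then have "p' \<le> a" using last fin R by blast
      then have "b \<le> q" using not_pair less by auto
      then show False using lateC[of b a] 2 \<open>p' \<le> a\<close> by simp
    qed
  qed
  then have "elusive n w (p', q') (R, C)"
    using R C unfolding elusive_def fulton_indices_def minor_indices_def
    by (auto simp: nw_rank_essential[OF w E'])
  then show ?thesis using that R C by blast
qed

text \<open>
  A Fulton generator that is not elusive attends a box of smaller rank, hence contains a Fulton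
  generator of that box; the descent in the rank ends at an elusive one.
\<close>

lemma contains_elusive:
  assumes "(p, q) \<in> essential_set n w"
    and "nw_rank n w p q + 1 \<le> card (R \<inter> {1..p})" "nw_rank n w p q + 1 \<le> card (C \<inter> {1..q})"
  shows "\<exists>p0 q0 R0 C0. (p0, q0) \<in> essential_set n w \<and> elusive n w (p0, q0) (R0, C0) \<and>
    R0 \<subseteq> R \<and> C0 \<subseteq> C \<and> nw_rank n w p0 q0 \<le> nw_rank n w p q"
  using assms
proof (induction "nw_rank n w p q" arbitrary: p q R C rule: less_induct)
  case less
  obtain R1 where R1: "R1 \<subseteq> R \<inter> {1..p}" "card R1 = nw_rank n w p q + 1"
    using obtain_subset_with_card_n[OF less.prems(2)] by metis
  obtain C1 where C1: "C1 \<subseteq> C \<inter> {1..q}" "card C1 = nw_rank n w p q + 1"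
    using obtain_subset_with_card_n[OF less.prems(3)] by metis
  show ?case
  proof (cases "elusive n w (p, q) (R1, C1)")
    case True
    then show ?thesis using less.prems(1) R1 C1 by blast
  next
    case False
    have "(R1, C1) \<in> fulton_indices n w p q"
      using R1 C1 unfolding fulton_indices_def minor_indices_def by auto
    then obtain a b where ab: "(a, b) \<in> essential_set n w" "nw_rank n w a b < nw_rank n w p q"
      and att: "attends n w (p, q) (R1, C1) (a, b)"
      using False unfolding elusive_def by auto
    have "nw_rank n w a b + 1 \<le> card (R1 \<inter> {1..a})" "nw_rank n w a b + 1 \<le> card (C1 \<inter> {1..b})"
      using att ab(2) by auto
    from less.hyps[OF ab(2,1) this] show ?thesis using R1 C1 ab(2)
      by (metis Int_subset_iff le_trans less_imp_le_nat subset_trans)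
  qed
qed

text \<open>
  A pair of essential boxes with the least rank at its southeastern box has an elusive minor there;
  the elusive minor found inside it is strictly smaller because the rank increases along the pair.
\<close>

lemma nested_elusive_indices:
  assumes w: "w permutes {1..n}" and "\<not> vexillary n w"
  obtains p q R C p0 q0 R0 C0 where
    "(p, q) \<in> essential_set n w" "elusive n w (p, q) (R, C)"
    "(p0, q0) \<in> essential_set n w" "elusive n w (p0, q0) (R0, C0)"
    "R0 \<subseteq> R" "C0 \<subseteq> C" "card R0 < card R"
proof -
  let ?pair = "\<lambda>(p, q, p', q'). (p, q) \<in> essential_set n w \<and> (p', q') \<in> essential_set n w \<and>
    p < p' \<and> q < q'"
  have "\<exists>x. ?pair x" using nonvexillary_essential_pair[OF assms] by auto
  then obtain x where x: "?pair x"
    "\<And>y. ?pair y \<Longrightarrow> (\<lambda>(p, q, p', q'). dot_count w p' q') x \<le> (\<lambda>(p, q, p', q'). dot_count w p' q') y"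
    using ex_has_least_nat[of ?pair _ "\<lambda>(p, q, p', q'). dot_count w p' q'"] by blast
  obtain p q p' q' where "x = (p, q, p', q')" by (cases x)
  with x have E: "(p, q) \<in> essential_set n w" "(p', q') \<in> essential_set n w" "p < p'" "q < q'"
    and minimal: "\<And>a b a' b'. (a, b) \<in> essential_set n w \<Longrightarrow> (a', b') \<in> essential_set n w \<Longrightarrow>
       a < a' \<Longrightarrow> b < b' \<Longrightarrow> dot_count w p' q' \<le> dot_count w a' b'"
    by auto
  obtain R C where RC: "elusive n w (p', q') (R, C)"
    "dot_count w p q + 1 \<le> card (R \<inter> {1..p})" "dot_count w p q + 1 \<le> card (C \<inter> {1..q})"
    using elusive_containing_smaller_fulton_indices[OF w E] minimal by metis
  obtain p0 q0 R0 C0 where small: "(p0, q0) \<in> essential_set n w" "elusive n w (p0, q0) (R0, C0)"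
    "R0 \<subseteq> R" "C0 \<subseteq> C" "nw_rank n w p0 q0 \<le> nw_rank n w p q"
    using contains_elusive[OF E(1), of R C] RC(2,3) nw_rank_essential[OF w E(1)] by metis
  have "card R0 = nw_rank n w p0 q0 + 1" "card R = nw_rank n w p' q' + 1"
    using small(2) RC(1) unfolding elusive_def fulton_indices_def minor_indices_def by auto
  then have "card R0 < card R"
    using small(5) dot_count_essential_less[OF w E(1,3,4)] nw_rank_essential[OF w] E by simp
  with that E(2) RC(1) small show ?thesis by blast
qed

section \<open>Monomials of generic minors\<close>

definition squarefree_monomial :: "(nat \<times> nat) set \<Rightarrow> monomial" where
  "squarefree_monomial S = (\<Sum>x\<in>S. Poly_Mapping.single x 1)"

lemma keys_squarefree_monomial:
  assumes "finite S"
  shows "Poly_Mapping.keys (squarefree_monomial S) = S"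
proof -
  have "Poly_Mapping.lookup (squarefree_monomial S) x = (if x \<in> S then 1 else 0)" for x
    unfolding squarefree_monomial_def lookup_sum using assms by (simp add: lookup_single when_def)
  then show ?thesis by (auto simp: in_keys_iff split: if_splits)
qed

definition graph_on :: "nat set \<Rightarrow> (nat \<Rightarrow> nat) \<Rightarrow> (nat \<times> nat) set" where
  "graph_on R \<sigma> = (\<lambda>i. (i, \<sigma> i)) ` R"

lemma finite_graph_on: "finite R \<Longrightarrow> finite (graph_on R \<sigma>)"
  unfolding graph_on_def by simp

lemma card_graph_on: "card (graph_on R \<sigma>) = card R"
  unfolding graph_on_def by (rule card_image) (auto simp: inj_on_def)

lemma graph_on_reindex:
  assumes "bij_betw \<rho> K R" "\<And>i. i \<in> K \<Longrightarrow> \<sigma> (\<rho> i) = g i"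
  shows "(\<lambda>i. (\<rho> i, g i)) ` K = graph_on R \<sigma>"
proof -
  have "graph_on R \<sigma> = (\<lambda>i. (\<rho> i, \<sigma> (\<rho> i))) ` K"
    using assms(1) unfolding graph_on_def bij_betw_def by (auto simp: image_image)
  then show ?thesis using assms(2) by simp
qed

lemma prod_single_one:
  "finite I \<Longrightarrow> (\<Prod>i\<in>I. Poly_Mapping.single (f i) 1 :: 'k::field mpoly) = Poly_Mapping.single (\<Sum>i\<in>I. f i) 1"
  by (induction I rule: finite_induct) (auto simp: mult_single)

text \<open>One-based counterpart of \<^const>\<open>pick\<close>, which enumerates zero-based index sets.\<close>

definition nth_index :: "nat set \<Rightarrow> nat \<Rightarrow> nat" where
  "nth_index R i = Suc (pick (Suc -` R) i)"

lemma card_vimage_Suc: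
  assumes "R \<subseteq> {1..n}"
  shows "card (Suc -` R) = card R"
proof -
  have "R = Suc ` (Suc -` R)"
  proof
    show "R \<subseteq> Suc ` (Suc -` R)"
    proof
      fix x assume "x \<in> R"
      with assms show "x \<in> Suc ` (Suc -` R)" by (cases x) auto
    qed
  qed auto
  then show ?thesis by (metis card_image inj_Suc inj_on_subset subset_UNIV)
qed

lemma Collect_less_Suc_vimage: "{i. i < n \<and> Suc i \<in> S} = Suc -` S" if "S \<subseteq> {1..n}"
  using that by auto

lemma bij_betw_nth_index:
  assumes "R \<subseteq> {1..n}"
  shows "bij_betw (nth_index R) {0..<card R} R"
proof -
  have inj: "inj_on (nth_index R) {0..<card R}"
  proof (rule linorder_inj_onI')
    fix i j assume "i \<in> {0..<card R}" "j \<in> {0..<card R}" "i < j"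
    then show "nth_index R i \<noteq> nth_index R j"
      using pick_mono[of j "Suc -` R" i] card_vimage_Suc[OF assms] unfolding nth_index_def by auto
  qed
  have "nth_index R ` {0..<card R} \<subseteq> R"
    using pick_in_set[of _ "Suc -` R"] card_vimage_Suc[OF assms] unfolding nth_index_def by auto
  moreover have "finite R" using assms finite_subset by blast
  ultimately have "nth_index R ` {0..<card R} = R"
    using card_image[OF inj] by (intro card_subset_eq) auto
  with inj show ?thesis unfolding bij_betw_def by simp
qed

context
  fixes n k :: nat and R C :: "nat set"
  assumes indices: "(R, C) \<in> minor_indices n n k"
begin

lemma index_sets: "R \<subseteq> {1..n}" "C \<subseteq> {1..n}" "card R = k" "card C = k"
  using indices unfolding minor_indices_def by auto

lemma minor_matrix_carrier: "minor_matrix n R C \<in> carrier_mat k k"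
  unfolding minor_matrix_def generic_matrix_def submatrix_def
  using index_sets card_vimage_Suc[OF index_sets(1)] card_vimage_Suc[OF index_sets(2)]
    Collect_less_Suc_vimage[OF index_sets(1)] Collect_less_Suc_vimage[OF index_sets(2)] by (auto simp: vimage_def)

lemma minor_matrix_entry:
  assumes "i < k" "j < k"
  shows "minor_matrix n R C $$ (i, j) =
    (Poly_Mapping.single (Poly_Mapping.single (nth_index R i, nth_index C j) 1) 1 :: 'k::field mpoly)"
proof -
  have "nth_index R i \<in> R" "nth_index C j \<in> C"
    using bij_betw_nth_index[OF index_sets(1)] bij_betw_nth_index[OF index_sets(2)] index_sets assms
    unfolding bij_betw_def by auto
  then have "pick (Suc -` R) i < n" "pick (Suc -` C) j < n" using index_sets unfolding nth_index_def by auto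
  then show ?thesis
    unfolding minor_matrix_def
    using assms index_sets card_vimage_Suc[OF index_sets(1)] card_vimage_Suc[OF index_sets(2)]
      Collect_less_Suc_vimage[OF index_sets(1)] Collect_less_Suc_vimage[OF index_sets(2)]
    by (subst submatrix_index) (auto simp: generic_matrix_def var_def nth_index_def vimage_def)
qed

lemma transversal_product:
  assumes "\<And>i. i < k \<Longrightarrow> f i < k"
  shows "(\<Prod>i = 0..<k. (minor_matrix n R C :: 'k::field mpoly mat) $$ (i, f i)) =
    Poly_Mapping.single (squarefree_monomial ((\<lambda>i. (nth_index R i, nth_index C (f i))) ` {0..<k})) 1"
proof -
  have inj: "inj_on (\<lambda>i. (nth_index R i, nth_index C (f i))) {0..<k}"
    using bij_betw_nth_index[OF index_sets(1)] index_sets unfolding bij_betw_def inj_on_def by auto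
  have "(\<Prod>i = 0..<k. (minor_matrix n R C :: 'k mpoly mat) $$ (i, f i)) =
    (\<Prod>i = 0..<k. Poly_Mapping.single (Poly_Mapping.single (nth_index R i, nth_index C (f i)) 1) 1)"
    using assms by (intro prod.cong) (auto simp: minor_matrix_entry)
  also have "\<dots> = Poly_Mapping.single (\<Sum>i = 0..<k. Poly_Mapping.single (nth_index R i, nth_index C (f i)) 1) 1"
    by (rule prod_single_one) simp
  finally show ?thesis unfolding squarefree_monomial_def sum.reindex[OF inj] by (simp add: comp_def)
qed

text \<open>
  Distinct permutations select distinct sets of entries, so no cancellation occurs in the Leibniz
  expansion of a minor of the generic matrix: each bijection from the rows to the columns
  contributes a term with coefficient \<open>1\<close> or \<open>-1\<close>.
\<close>

lemma transversal_in_keys_minor: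
  assumes \<sigma>: "bij_betw \<sigma> R C"
  shows "squarefree_monomial (graph_on R \<sigma>) \<in> Poly_Mapping.keys (minor n R C :: 'k::field mpoly)"
proof -
  let ?K = "{0..<k}"
  have \<rho>: "bij_betw (nth_index R) ?K R" and \<gamma>: "bij_betw (nth_index C) ?K C"
    using bij_betw_nth_index[OF index_sets(1)] bij_betw_nth_index[OF index_sets(2)] index_sets(3,4) by simp_all
  let ?T = "\<lambda>\<pi>. (\<lambda>i. (nth_index R i, nth_index C (\<pi> i))) ` ?K"
  define \<gamma>' where "\<gamma>' = the_inv_into ?K (nth_index C)"
  have \<gamma>': "bij_betw \<gamma>' C ?K" unfolding \<gamma>'_def by (rule bij_betw_the_inv_into[OF \<gamma>])
  define \<pi> where "\<pi> i = (if i \<in> ?K then \<gamma>' (\<sigma> (nth_index R i)) else i)" for i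
  have "bij_betw (\<gamma>' \<circ> (\<sigma> \<circ> nth_index R)) ?K ?K"
    by (rule bij_betw_trans[OF bij_betw_trans[OF \<rho> \<sigma>] \<gamma>'])
  then have "bij_betw \<pi> ?K ?K" by (rule bij_betw_cong[THEN iffD1, rotated]) (auto simp: \<pi>_def)
  then have \<pi>: "\<pi> permutes ?K" by (rule bij_imp_permutes) (auto simp: \<pi>_def)
  have "\<sigma> (nth_index R i) = nth_index C (\<pi> i)" if "i \<in> ?K" for i
  proof -
    have "\<sigma> (nth_index R i) \<in> C" using \<rho> \<sigma> that unfolding bij_betw_def by auto
    then show ?thesis using \<gamma> that unfolding \<pi>_def \<gamma>'_def
      by (simp add: f_the_inv_into_f_bij_betw)
  qed
  then have T\<pi>: "?T \<pi> = graph_on R \<sigma>"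
    by (rule graph_on_reindex[OF \<rho>])
  have unique: "\<tau> = \<pi>" if \<tau>: "\<tau> permutes ?K" and eq: "squarefree_monomial (?T \<tau>) = squarefree_monomial (?T \<pi>)" for \<tau>
  proof
    fix i
    have T: "?T \<tau> = ?T \<pi>"
      using arg_cong[OF eq, of Poly_Mapping.keys] by (simp add: keys_squarefree_monomial)
    show "\<tau> i = \<pi> i"
    proof (cases "i \<in> ?K")
      case True
      then have "(nth_index R i, nth_index C (\<tau> i)) \<in> ?T \<pi>" using T by blast
      then obtain j where j: "j \<in> ?K" "nth_index R i = nth_index R j" "nth_index C (\<tau> i) = nth_index C (\<pi> j)"
        by auto
      have "i = j" by (rule inj_onD[OF bij_betw_imp_inj_on[OF \<rho>] j(2) True j(1)])
      moreover have "\<tau> i \<in> ?K" "\<pi> j \<in> ?K"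
        using permutes_in_image[OF \<tau>, of i] permutes_in_image[OF \<pi>, of j] True j(1) by simp_all
      then have "\<tau> i = \<pi> j" by (rule inj_onD[OF bij_betw_imp_inj_on[OF \<gamma>] j(3)])
      ultimately show ?thesis by simp
    qed (use \<tau> \<pi> in \<open>simp add: permutes_not_in\<close>)
  qed
  have "(minor n R C :: 'k mpoly) = (\<Sum>\<tau> | \<tau> permutes ?K. signof \<tau> * (\<Prod>i = 0..<k. minor_matrix n R C $$ (i, \<tau> i)))"
    unfolding minor_def by (rule det_def'[OF minor_matrix_carrier])
  also have "\<dots> = (\<Sum>\<tau> | \<tau> permutes ?K. signof \<tau> * Poly_Mapping.single (squarefree_monomial (?T \<tau>)) 1)"
  proof (rule sum.cong)
    fix \<tau> assume "\<tau> \<in> {\<tau>. \<tau> permutes ?K}"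
    then have "\<tau> i < k" if "i < k" for i using permutes_in_image[of \<tau> ?K i] that by auto
    then show "signof \<tau> * (\<Prod>i = 0..<k. minor_matrix n R C $$ (i, \<tau> i)) =
       (signof \<tau> * Poly_Mapping.single (squarefree_monomial (?T \<tau>)) 1 :: 'k mpoly)"
      by (simp add: transversal_product)
  qed simp
  also have "\<dots> = (\<Sum>\<tau> | \<tau> permutes ?K. Poly_Mapping.single (squarefree_monomial (?T \<tau>)) (signof \<tau>))"
    by (intro sum.cong) (auto simp: sign_def single_uminus)
  finally have "Poly_Mapping.lookup (minor n R C :: 'k mpoly) (squarefree_monomial (?T \<pi>)) =
    (\<Sum>\<tau> | \<tau> permutes ?K. if \<tau> = \<pi> then signof \<tau> else 0)"
    using unique by (auto simp: lookup_sum lookup_single when_def intro!: sum.cong)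
  also have "\<dots> = signof \<pi>" using \<pi> by (simp add: finite_permutations)
  finally show ?thesis unfolding T\<pi> by (simp add: in_keys_iff sign_def)
qed

text \<open>
  The antidiagonal is a transversal: it belongs to the order-reversing bijection between the rows
  and the columns.
\<close>

lemma lead_monomial_minor:
  assumes r: "antidiagonal_term_order TYPE('k::field) n r" and k: "k \<in> {1..n}"
  shows "\<exists>\<sigma>. bij_betw \<sigma> R C \<and>
    lead_monomial r (minor n R C :: 'k mpoly) = squarefree_monomial (graph_on R \<sigma>)"
proof -
  let ?K = "{0..<k}"
  have \<rho>: "bij_betw (nth_index R) ?K R" and \<gamma>: "bij_betw (nth_index C) ?K C"
    using bij_betw_nth_index[OF index_sets(1)] bij_betw_nth_index[OF index_sets(2)] index_sets(3,4) by simp_all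
  have rev: "bij_betw (\<lambda>i. k - 1 - i) ?K ?K"
    by (rule bij_betw_byWitness[where f' = "\<lambda>i. k - 1 - i"]) auto
  let ?\<rho>' = "the_inv_into ?K (nth_index R)"
  define \<sigma> where "\<sigma> = nth_index C \<circ> ((\<lambda>i. k - 1 - i) \<circ> ?\<rho>')"
  have \<sigma>: "bij_betw \<sigma> R C" unfolding \<sigma>_def
    by (rule bij_betw_trans[OF bij_betw_trans[OF bij_betw_the_inv_into[OF \<rho>] rev] \<gamma>])
  have "\<sigma> (nth_index R i) = nth_index C (k - 1 - i)" if "i \<in> ?K" for i
    using that \<rho> unfolding \<sigma>_def bij_betw_def by (simp add: the_inv_into_f_f)
  then have T: "(\<lambda>i. (nth_index R i, nth_index C (k - 1 - i))) ` ?K = graph_on R \<sigma>"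
    by (rule graph_on_reindex[OF \<rho>])
  have "lead_term r (minor n R C :: 'k mpoly) = (\<Prod>i<k. minor_matrix n R C $$ (i, k - 1 - i))"
    using r k indices unfolding antidiagonal_term_order_def by blast
  also have "\<dots> = Poly_Mapping.single (squarefree_monomial (graph_on R \<sigma>)) 1"
    using transversal_product[of "\<lambda>i. k - 1 - i"] T by (simp add: lessThan_atLeast0)
  finally have "Poly_Mapping.keys (Poly_Mapping.single (lead_monomial r (minor n R C :: 'k mpoly)) (1 :: 'k)) =
      Poly_Mapping.keys (Poly_Mapping.single (squarefree_monomial (graph_on R \<sigma>)) (1 :: 'k))"
    unfolding lead_term_def by simp
  then show ?thesis using \<sigma> by auto
qed

end

text \<open>
  The leading transversal of the small minor extends to a transversal of the large one, by any
  bijection between the remaining rows and columns.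
\<close>

lemma lead_monomial_dvd_term_of_larger_minor:
  assumes r: "antidiagonal_term_order TYPE('k::field) n r"
    and small: "(R0, C0) \<in> minor_indices n n k0" "k0 \<in> {1..n}"
    and large: "(R, C) \<in> minor_indices n n k"
    and sub: "R0 \<subseteq> R" "C0 \<subseteq> C"
  shows "\<exists>m \<in> Poly_Mapping.keys (minor n R C :: 'k mpoly).
    monomial_dvd (lead_monomial r (minor n R0 C0 :: 'k mpoly)) m"
proof -
  obtain \<sigma> where \<sigma>: "bij_betw \<sigma> R0 C0"
    "lead_monomial r (minor n R0 C0 :: 'k mpoly) = squarefree_monomial (graph_on R0 \<sigma>)"
    using lead_monomial_minor[OF small(1) r small(2)] by blast
  have fin: "finite R" "finite C" and card: "card R0 = card C0" "card R = card C"
    using small large unfolding minor_indices_def by (auto intro: finite_subset)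
  then have "card (R - R0) = card (C - C0)"
    using sub by (simp add: card_Diff_subset finite_subset)
  then obtain \<tau> where \<tau>: "bij_betw \<tau> (R - R0) (C - C0)"
    using fin by (metis finite_Diff finite_same_card_bij)
  define \<upsilon> where "\<upsilon> i = (if i \<in> R0 then \<sigma> i else \<tau> i)" for i
  have "bij_betw \<upsilon> (R0 \<union> (R - R0)) (C0 \<union> (C - C0))"
    unfolding \<upsilon>_def by (rule bij_betw_disjoint_Un[OF \<sigma>(1) \<tau>]) auto
  then have "bij_betw \<upsilon> R C" using sub by (simp add: Un_absorb1)
  then have "squarefree_monomial (graph_on R \<upsilon>) \<in> Poly_Mapping.keys (minor n R C :: 'k mpoly)"
    by (rule transversal_in_keys_minor[OF large])
  moreover have "graph_on R \<upsilon> = graph_on R0 \<sigma> \<union> graph_on (R - R0) \<tau>"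
    using sub unfolding graph_on_def \<upsilon>_def by auto
  then have "squarefree_monomial (graph_on R \<upsilon>) =
      squarefree_monomial (graph_on R0 \<sigma>) + squarefree_monomial (graph_on (R - R0) \<tau>)"
    unfolding squarefree_monomial_def using fin sub
    by (simp add: finite_subset finite_graph_on graph_on_def sum.union_disjoint image_iff Int_def disjoint_iff)
  ultimately show ?thesis using \<sigma>(2) unfolding monomial_dvd_def by metis
qed

text \<open>The number of variables in the leading monomial is the size of the minor.\<close>

lemma minors_of_different_size:
  assumes r: "antidiagonal_term_order TYPE('k::field) n r"
    and A: "(R0, C0) \<in> minor_indices n n k0" "k0 \<in> {1..n}"
    and B: "(R, C) \<in> minor_indices n n k" "k \<in> {1..n}" and "k0 \<noteq> k"
  shows "(minor n R0 C0 :: 'k mpoly) \<noteq> minor n R C"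
proof
  assume eq: "(minor n R0 C0 :: 'k mpoly) = minor n R C"
  obtain \<sigma> \<tau> where "squarefree_monomial (graph_on R0 \<sigma>) = squarefree_monomial (graph_on R \<tau>)"
    using lead_monomial_minor[OF A(1) r A(2)] lead_monomial_minor[OF B(1) r B(2)] eq by metis
  moreover have "finite R0" "finite R" "card R0 = k0" "card R = k"
    using A B unfolding minor_indices_def by (auto intro: finite_subset)
  ultimately show False
    using \<open>k0 \<noteq> k\<close> by (metis keys_squarefree_monomial finite_graph_on card_graph_on)
qed

section \<open>Reducedness forces vexillarity\<close>

theorem theorem4p11:
  fixes n :: nat and w :: "nat \<Rightarrow> nat" and r :: "monomial rel"
  assumes "w permutes {1..n}"
    and "antidiagonal_term_order TYPE('k::field) n r"
    and "reduced_groebner_basis n r (schubert_ideal n w :: 'k mpoly set) (elusive_minors n w)"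
  shows "vexillary n w"
proof (rule ccontr)
  assume "\<not> vexillary n w"
  then obtain p q R C p0 q0 R0 C0 where
    E: "(p, q) \<in> essential_set n w" "elusive n w (p, q) (R, C)"
    and E0: "(p0, q0) \<in> essential_set n w" "elusive n w (p0, q0) (R0, C0)"
    and sub: "R0 \<subseteq> R" "C0 \<subseteq> C" and less: "card R0 < card R"
    using nested_elusive_indices[OF assms(1)] by metis
  have idx: "(R', C') \<in> minor_indices n n (card R') \<and> card R' \<in> {1..n}"
    if "(p', q') \<in> essential_set n w" "elusive n w (p', q') (R', C')" for p' q' R' C'
  proof -
    have "R' \<subseteq> {1..n}" "C' \<subseteq> {1..n}" "card C' = card R'" "1 \<le> card R'"
      using that essential_set_bounds[OF that(1)]
      unfolding elusive_def fulton_indices_def minor_indices_def by fastforce+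
    then show ?thesis using card_mono[of "{1..n}" R'] unfolding minor_indices_def by auto
  qed
  let ?g = "minor n R C :: 'k mpoly" and ?h = "minor n R0 C0 :: 'k mpoly"
  have "?g \<in> elusive_minors n w" "?h \<in> elusive_minors n w"
    using E E0 unfolding elusive_minors_def by blast+
  moreover have "?h \<noteq> ?g"
    using minors_of_different_size[OF assms(2)] idx E E0 less by (metis nat_neq_iff)
  moreover have "\<exists>m \<in> Poly_Mapping.keys ?g. monomial_dvd (lead_monomial r ?h) m"
    using lead_monomial_dvd_term_of_larger_minor[OF assms(2)] idx E E0 sub by metis
  ultimately show False using assms(3) unfolding reduced_groebner_basis_def by blast
qed

end
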